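(* Let $X=\{x_1,\dots,x_N\}$ be the old data, $\Delta X=\{x_{N+1},\dots,x_{N+\Delta N}\}$ the new data, $X'=X\cup\Delta X$ all data, with noise distributions $p_n^{X}, p_n^{\Delta X}, p_n^{X'}$ given by uniform sampling from $X$, $\Delta X$, $X'$ respectively. Let $\alpha=\frac{\Delta N}{N+\Delta N}$. Then for every old data point $x_i\in X$, the InfoNCE loss with noise distribution from all data equals the InfoNCE loss with noise distribution from the old data plus the incremental InfoNCE (NCE-II) loss: $$\mathcal{L}_i^{I,X'}=\mathcal{L}_i^{I,X}+\mathcal{L}_i^{II},$$ where all three losses are evaluated for the same encoder $\phi$, the same positive sample $x_i^+$ and the same constant $K$.
   Context: Setting. $\mathcal{X}$ is a data space, $\mathcal{Z}$ a latent space, $\phi:\mathcal{X}\to\mathcal{Z}$ an encoder, $sim:\mathcal{Z}\times\mathcal{Z}\to\mathbb{R}$ a similarity function, $\tau>0$ a temperature, and $f(x,y)=\exp\big(sim(\phi(x),\phi(y))/\tau\big)>0$. The old data are $X=\{x_i\in\mathcal{X}\}_{i=1}^{N}$ with $N\ge 1$, the new data are $\Delta X=\{x_{N+i}\in\mathcal{X}\}_{i=1}^{\Delta N}$ with $\Delta N\ge 0$, and $X'=X\cup\Delta X$ (data are treated as indexed families, so $X'$ has $N+\Delta N$ entries). Each $x_i$ comes with a given positive sample $x_i^+\in\mathcal{X}$ (produced by data augmentation). $K>0$ is a fixed constant (ratio of negative to positive samples). Noise distribution. For a finite indexed family $S$ of data, $p_n^{S}$ is the uniform distribution over the entries of $S$,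 so $\mathbb{E}_{x^-\sim p_n^S} f(x_i,x^-)=\frac{1}{|S|}\sum_{x_j\in S}f(x_i,x_j)$. InfoNCE loss (NCE-I). For $S\in\{X,X'\}$, $$\mathcal{L}_i^{I,S}=-\log\frac{f(x_i,x_i^+)}{f(x_i,x_i^+)+K\,\mathbb{E}_{x_i^-\sim p_n^{S}}f(x_i,x_i^-)}.$$ Change ratio of the noise distribution: $$r_i^{X\to\Delta X}=\frac{f(x_i,x_i^+)+K\,\mathbb{E}_{x_i^-\sim p_n^{\Delta X}}f(x_i,x_i^-)}{f(x_i,x_i^+)+K\,\mathbb{E}_{x_i^-\sim p_n^{X}}f(x_i,x_i^-)}.$$ Incremental InfoNCE loss (NCE-II), for $x_i\in X$: $$\mathcal{L}_i^{II}=\log\big(\alpha\cdot r_i^{X\to\Delta X}+(1-\alpha)\cdot 1\big),\qquad \alpha=\frac{\Delta N}{N+\Delta N}\in[0,1).$$ If $\Delta N=0$, then $\alpha=0$ and the term $\alpha\, r_i^{X\to\Delta X}$ is read as $0$. *)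

theory Defs
  imports "HOL-Probability.Probability"
begin

definition score :: "('z \<Rightarrow> 'z \<Rightarrow> real) \<Rightarrow> ('x \<Rightarrow> 'z) \<Rightarrow> real \<Rightarrow> 'x \<Rightarrow> 'x \<Rightarrow> real" where
  "score sim \<phi> \<tau> a b = exp (sim (\<phi> a) (\<phi> b) / \<tau>)"

text \<open>
  Data are a family \<open>x\<close> indexed by natural numbers, and a data set is given by its index set
  \<open>I\<close>. Sampling an index uniformly and pushing forward along \<open>x\<close> counts repeated data with
  multiplicity. For empty \<open>I\<close> the distribution is an unspecified one.
\<close>

definition noise :: "(nat \<Rightarrow> 'x) \<Rightarrow> nat set \<Rightarrow> 'x pmf" where
  "noise x I = map_pmf x (pmf_of_set I)"

definition old_idx :: "nat \<Rightarrow> nat set" where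
  "old_idx N = {1..N}"

definition new_idx :: "nat \<Rightarrow> nat \<Rightarrow> nat set" where
  "new_idx N \<Delta>N = {N + 1..N + \<Delta>N}"

definition all_idx :: "nat \<Rightarrow> nat \<Rightarrow> nat set" where
  "all_idx N \<Delta>N = old_idx N \<union> new_idx N \<Delta>N"

text \<open>
  In the following, \<open>f\<close> is the score, \<open>a\<close> a data point, \<open>a'\<close> its positive sample, and
  \<open>p\<close>, \<open>q\<close> are noise distributions.
\<close>

definition partition_term :: "('x \<Rightarrow> 'x \<Rightarrow> real) \<Rightarrow> real \<Rightarrow> 'x \<Rightarrow> 'x \<Rightarrow> 'x pmf \<Rightarrow> real" where
  "partition_term f K a a' p = f a a' + K * measure_pmf.expectation p (\<lambda>b. f a b)"

definition infonce_loss :: "('x \<Rightarrow> 'x \<Rightarrow> real) \<Rightarrow> real \<Rightarrow> 'x \<Rightarrow> 'x \<Rightarrow> 'x pmf \<Rightarrow> real" where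
  "infonce_loss f K a a' p = - ln (f a a' / partition_term f K a a' p)"

definition change_ratio ::
  "('x \<Rightarrow> 'x \<Rightarrow> real) \<Rightarrow> real \<Rightarrow> 'x \<Rightarrow> 'x \<Rightarrow> 'x pmf \<Rightarrow> 'x pmf \<Rightarrow> real" where
  "change_ratio f K a a' p q = partition_term f K a a' q / partition_term f K a a' p"

text \<open>
  For \<open>\<Delta>N = 0\<close> the distribution on the new data is unspecified, but its change ratio is still
  a real number and is multiplied by \<open>\<alpha> = 0\<close>, so that summand is \<open>0\<close>.
\<close>

definition incremental_infonce_loss ::
  "('x \<Rightarrow> 'x \<Rightarrow> real) \<Rightarrow> real \<Rightarrow> (nat \<Rightarrow> 'x) \<Rightarrow> nat \<Rightarrow> nat \<Rightarrow> 'x \<Rightarrow> 'x \<Rightarrow> real" where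
  "incremental_infonce_loss f K x N \<Delta>N a a' =
    (let \<alpha> = real \<Delta>N / (real N + real \<Delta>N);
         r = change_ratio f K a a' (noise x (old_idx N)) (noise x (new_idx N \<Delta>N))
     in ln (\<alpha> * r + (1 - \<alpha>) * 1))"

end

theory Submission
  imports Defs
begin

text \<open>
  Uniform sampling from all data is the mixture, with weights \<open>\<alpha>\<close> and \<open>1 - \<alpha>\<close>, of uniform sampling
  from the new and from the old data. Hence the denominator of the InfoNCE loss over all data is the
  same mixture of the two denominators. Dividing by the denominator over the old data gives the
  argument of the logarithm in the incremental loss.
\<close>

lemma expectation_noise:
  fixes g :: "'x \<Rightarrow> real"
  assumes "finite I" "I \<noteq> {}"
  shows "measure_pmf.expectation (noise x I) g = (\<Sum>j\<in>I. g (x j)) / real (card I)"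
  using assms by (simp add: noise_def integral_pmf_of_set)

text \<open>The expectation is nonnegative for every pmf: where \<open>f a\<close> is not
  integrable, the Bochner integral is 0 by convention. This covers the unspecified noise
  distribution of an empty index set as well.\<close>

lemma partition_term_pos:
  assumes "\<And>b. f a b > 0" "K > 0"
  shows "partition_term f K a a' p > 0"
proof -
  have "measure_pmf.expectation p (\<lambda>b. f a b) \<ge> 0"
    using assms(1) by (intro integral_nonneg_AE) (simp add: less_imp_le)
  then show ?thesis
    using assms by (simp add: partition_term_def add_pos_nonneg)
qed

text \<open>Each index has weight 1 / (N + \<Delta>N) in the full family, which is \<alpha> /
  \<Delta>N for a new index and (1 - \<alpha>) / N for an old one. Indices, not data values, are
  what must be disjoint, so repeated data do no harm.\<close>

lemma expectation_noise_all_idx: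
  fixes g :: "'x \<Rightarrow> real" and N \<Delta>N :: nat
  assumes "N \<ge> 1"
  defines "\<alpha> \<equiv> real \<Delta>N / (real N + real \<Delta>N)"
  shows "measure_pmf.expectation (noise x (all_idx N \<Delta>N)) g =
    \<alpha> * measure_pmf.expectation (noise x (new_idx N \<Delta>N)) g +
    (1 - \<alpha>) * measure_pmf.expectation (noise x (old_idx N)) g"
proof (cases "\<Delta>N = 0")
  \<comment> \<open>Here \<alpha> = 0 annihilates the expectation under the unspecified
    distribution, and \<open>all_idx\<close> collapses to \<open>old_idx\<close>.\<close>
  case True
  then show ?thesis by (simp add: \<alpha>_def all_idx_def new_idx_def)
next
  case False
  have fin: "finite (old_idx N)" "finite (new_idx N \<Delta>N)" "finite (all_idx N \<Delta>N)"
    and ne: "old_idx N \<noteq> {}" "new_idx N \<Delta>N \<noteq> {}" "all_idx N \<Delta>N \<noteq> {}"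
    and disj: "old_idx N \<inter> new_idx N \<Delta>N = {}"
    using assms(1) False by (auto simp: old_idx_def new_idx_def all_idx_def)
  have card: "card (old_idx N) = N" "card (new_idx N \<Delta>N) = \<Delta>N"
    by (simp_all add: old_idx_def new_idx_def)
  have card_all: "card (all_idx N \<Delta>N) = N + \<Delta>N"
    using card_Un_disjoint[OF fin(1,2) disj] by (simp add: all_idx_def card)
  have sum_all: "(\<Sum>j\<in>all_idx N \<Delta>N. g (x j)) =
      (\<Sum>j\<in>old_idx N. g (x j)) + (\<Sum>j\<in>new_idx N \<Delta>N. g (x j))"
    unfolding all_idx_def by (rule sum.union_disjoint[OF fin(1,2) disj])
  have pos: "real N > 0" "real \<Delta>N > 0" "real N + real \<Delta>N > 0"
    using assms(1) False by auto
  \<comment> \<open>In this form the numerator N cancels the cardinality in the average over the old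
    data, as \<Delta>N does for the new data.\<close>
  have "1 - \<alpha> = real N / (real N + real \<Delta>N)"
    using pos by (simp add: \<alpha>_def field_simps)
  then show ?thesis
    using pos fin ne
    by (simp add: expectation_noise card card_all sum_all \<alpha>_def add_divide_distrib)
qed

text \<open>The partition term is affine in the expectation, and the weights \<alpha> and 1 -
  \<alpha> add up to 1, so the constant summand \<open>f a a'\<close> is preserved.\<close>

lemma partition_term_all_idx:
  fixes N \<Delta>N :: nat
  assumes "N \<ge> 1"
  defines "\<alpha> \<equiv> real \<Delta>N / (real N + real \<Delta>N)"
  shows "partition_term f K a a' (noise x (all_idx N \<Delta>N)) =
    \<alpha> * partition_term f K a a' (noise x (new_idx N \<Delta>N)) +
    (1 - \<alpha>) * partition_term f K a a' (noise x (old_idx N))"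
  unfolding partition_term_def expectation_noise_all_idx[OF assms(1)] \<alpha>_def
  by (simp add: algebra_simps)

theorem theorem1:
  fixes sim :: "'z \<Rightarrow> 'z \<Rightarrow> real" and \<phi> :: "'x \<Rightarrow> 'z" and \<tau> K :: real
    and N \<Delta>N i :: nat and x xpos :: "nat \<Rightarrow> 'x"
  assumes "\<tau> > 0" and "K > 0" and "N \<ge> 1" and "i \<in> old_idx N"
  shows "infonce_loss (score sim \<phi> \<tau>) K (x i) (xpos i) (noise x (all_idx N \<Delta>N)) =
         infonce_loss (score sim \<phi> \<tau>) K (x i) (xpos i) (noise x (old_idx N)) +
         incremental_infonce_loss (score sim \<phi> \<tau>) K x N \<Delta>N (x i) (xpos i)"
proof -
  define f where "f = score sim \<phi> \<tau>"
  define Z where "Z I = partition_term f K (x i) (xpos i) (noise x I)" for I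
  define \<alpha> where "\<alpha> = real \<Delta>N / (real N + real \<Delta>N)"
  have f_pos: "f a b > 0" for a b
    by (simp add: f_def score_def)
  have Z_pos: "Z I > 0" for I
    unfolding Z_def using f_pos assms(2) by (rule partition_term_pos)
  \<comment> \<open>The positive-pair term is the same for every \<open>I\<close>, so the two
    InfoNCE losses differ only by a difference of \<open>ln (Z I)\<close>.\<close>
  have loss: "infonce_loss f K (x i) (xpos i) (noise x I) = ln (Z I) - ln (f (x i) (xpos i))" for I
    using f_pos[of "x i" "xpos i"] Z_pos[of I]
    by (simp add: infonce_loss_def ln_div flip: Z_def)
  have "\<alpha> * (Z (new_idx N \<Delta>N) / Z (old_idx N)) + (1 - \<alpha>) * 1 = Z (all_idx N \<Delta>N) / Z (old_idx N)"
    using Z_pos[of "old_idx N"] partition_term_all_idx[OF assms(3), of f K "x i" "xpos i" x \<Delta>N]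
    by (simp add: Z_def \<alpha>_def add_divide_distrib)
  then have "incremental_infonce_loss f K x N \<Delta>N (x i) (xpos i) =
      ln (Z (all_idx N \<Delta>N) / Z (old_idx N))"
    by (simp add: incremental_infonce_loss_def change_ratio_def Let_def flip: Z_def \<alpha>_def)
  also have "\<dots> = ln (Z (all_idx N \<Delta>N)) - ln (Z (old_idx N))"
    using Z_pos[of "all_idx N \<Delta>N"] Z_pos[of "old_idx N"] by (simp add: ln_div)
  finally show ?thesis
    using loss unfolding f_def by simp
qed

end
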